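(* Consider the asynchronous inertial forward-backward iteration $x_{k+1}=x_k+\eta(Tx_k-x_k+e_k)=x_k-\eta(Sx_k-e_k)$ described in the context, let $x_\ast\in\operatorname{zer}S$ and $\mathrm{dist}_k=\|x_k-x_\ast\|$. Let $\gamma\in(0,\gamma_{\max})$, $\delta>0$, $\epsilon\in(0,\nu)$ and $\beta>0$, where the upper bound $\gamma_{\max}$ ensures that the stepsize $\gamma$ is admissible (a possible option is, e.g., $\gamma_{\max}=2/L$, for which $T_B$ is nonexpansive and $S$ is $1/2$-cocoercive). Put $$Y=1+\gamma L+2\beta,\qquad X=N(YN+1)\bigl(4\tau(1+\gamma L)+6\beta\tau\bigr),$$ $$r(\eta)=1-\eta(\nu-\epsilon),\qquad q(\eta)=\eta^3X^2\left(\frac1\epsilon+\frac{\eta(1+\delta)}{\delta}\right).$$ If $\eta>0$ and $$\eta<\min\left\{\frac{1}{2(1+\delta)},\ \frac1X\sqrt{\frac{2\delta\epsilon(\nu-\epsilon)}{2\delta+\epsilon}}\right\},$$ then $r(\eta)+q(\eta)<1$ and the iteration converges at a linear rate, in the sense that $$\mathrm{dist}_k^2\le s^k\,\mathrm{dist}_0^2,\quad k\ge1,\qquad s=\bigl(r(\eta)+q(\eta)\bigr)^{\frac{1}{1+6\tau}}.$$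
   Context: Setting. $\mathcal H=\mathcal H_1\times\cdots\times\mathcal H_N$ is a product of Hilbert spaces; $x[i]\in\mathcal H_i$ denotes the $i$-th block of $x\in\mathcal H$. Operators and standing assumptions. $T_A:\mathcal H\to\mathcal H$ is separable, $T_A=(T_{A_1},\dots,T_{A_N})$ with $T_{A_i}:\mathcal H_i\to\mathcal H_i$, and nonexpansive (1-Lipschitz). $T_B=I-\gamma B$ with $\gamma>0$, where $B:\mathcal H\to\mathcal H$ is $1/L$-cocoercive, i.e. $\langle x-y,Bx-By\rangle\ge\frac1L\|Bx-By\|^2$ for all $x,y\in\mathcal H$. $T=T_A\circ T_B$ and $S=I-T$; $\operatorname{zer}S=\{x:Sx=0\}$ is the set of fixed points of $T$. $S$ is quasi-$\nu$-strongly monotone for some $\nu>0$: $\langle x-y,Sx\rangle\ge\nu\|x-y\|^2$ for all $x\in\mathcal H$, $y\in\operatorname{zer}S$. "$1/2$-cocoercive" for $S$ means $\langle x-y,Sx-Sy\rangle\ge\frac12\|Sx-Sy\|^2$ for all $x,y$. Asynchronous iteration. There are $N$ agents, agent $i$ being assigned block $i$ and owning $T_{A_i}$, and a coordinator holding the global variable $x$. Each agent writes to the coordinator state at least once every $\tau$ time epochs, so the data used at iteration $k$ are outdated by bounded amounts. The vector last read by agent $i$ is a past iterate $x_{k-l}=x_k-a_k^i$ for some $l\in\{1,\dots,2\tau\}$; the last written value of block $i$ is $x_{k-l}[i]=x_k[i]-b_k^i[i]$ for some $l\in\{1,\dots,2\tau\}$; the previous written value of block $i$ is $x_{k-l}[i]=x_k[i]-c_k^i[i]$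 for some $l\in\{1,\dots,3\tau\}$. The three delays $l$ need not be equal and depend on $i$ and $k$; each of $a_k^i,b_k^i,c_k^i$ has the form $\sum_{m=k-l}^{k-1}(x_{m+1}-x_m)$ with the corresponding $l$. The vectors $a_k,b_k,c_k\in\mathcal H$ are assembled blockwise: $a_k=\{a_k^i[i]\}_{i=1}^N$, $b_k=\{b_k^i[i]\}_{i=1}^N$, $c_k=\{c_k^i[i]\}_{i=1}^N$. Put $$d_k=\gamma Bx_k-\gamma B(x_k-a_k)-a_k,$$ $$e_k=T_A\bigl(T_Bx_k+d_k+\beta(c_k-b_k)\bigr)-T_AT_Bx_k,$$ where $\beta$ is the inertia constant and $\eta$ the relaxation parameter of the iteration $x_{k+1}=x_k+\eta(Tx_k-x_k+e_k)=x_k-\eta(Sx_k-e_k)$. *)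

theory Defs
  imports "HOL-Analysis.Analysis"
begin

(* The product of N = CARD('n) Hilbert spaces.  HOL has no products over a family of types, so the
   i-th Hilbert space is a subspace H i, complete in its own right, of an inner product space 'h
   that only serves as a common carrier; the H i may differ from each other.  The inner product and
   the norm of 'h^'n are those of the Hilbert-space product, and x $ i is the block x[i]. *)
definition hilbert_family :: "('n \<Rightarrow> 'h::real_inner set) \<Rightarrow> bool" where
  "hilbert_family H \<longleftrightarrow> (\<forall>i. subspace (H i) \<and> complete (H i))"

definition hilbert_prod :: "('n::finite \<Rightarrow> 'h::real_inner set) \<Rightarrow> ('h^'n) set" where
  "hilbert_prod H = {x. \<forall>i. x $ i \<in> H i}"

definition separable_op :: "('n::finite \<Rightarrow> 'h \<Rightarrow> 'h) \<Rightarrow> 'h^'n \<Rightarrow> 'h^'n" where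
  "separable_op A x = (\<chi> i. A i (x $ i))"

definition cocoercive_on :: "'a::real_inner set \<Rightarrow> real \<Rightarrow> ('a \<Rightarrow> 'a) \<Rightarrow> bool" where
  "cocoercive_on K c F \<longleftrightarrow>
     (\<forall>x\<in>K. \<forall>y\<in>K. (x - y) \<bullet> (F x - F y) \<ge> c * (norm (F x - F y))\<^sup>2)"

definition zer :: "'a::real_inner set \<Rightarrow> ('a \<Rightarrow> 'a) \<Rightarrow> 'a set" where
  "zer K F = {x \<in> K. F x = 0}"

definition quasi_strongly_monotone_on :: "'a::real_inner set \<Rightarrow> real \<Rightarrow> ('a \<Rightarrow> 'a) \<Rightarrow> bool" where
  "quasi_strongly_monotone_on K \<nu> F \<longleftrightarrow>
     (\<forall>x\<in>K. \<forall>y\<in>zer K F. (x - y) \<bullet> F x \<ge> \<nu> * (norm (x - y))\<^sup>2)"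

definition T_fwd :: "real \<Rightarrow> ('a::real_inner \<Rightarrow> 'a) \<Rightarrow> 'a \<Rightarrow> 'a" where
  "T_fwd \<gamma> B x = x - \<gamma> *\<^sub>R B x"

definition T_fb :: "('a::real_inner \<Rightarrow> 'a) \<Rightarrow> real \<Rightarrow> ('a \<Rightarrow> 'a) \<Rightarrow> 'a \<Rightarrow> 'a" where
  "T_fb TA \<gamma> B = TA \<circ> T_fwd \<gamma> B"

definition S_fb :: "('a::real_inner \<Rightarrow> 'a) \<Rightarrow> real \<Rightarrow> ('a \<Rightarrow> 'a) \<Rightarrow> 'a \<Rightarrow> 'a" where
  "S_fb TA \<gamma> B x = x - T_fb TA \<gamma> B x"

(* Admissibility of the stepsizes in (0, \<gamma>max) means that S is 1/2-cocoercive for each of them;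
   \<gamma>max = 2/L is one possible choice, see admissible_bound_two_over_L below. *)
definition admissible_bound ::
    "'a::real_inner set \<Rightarrow> ('a \<Rightarrow> 'a) \<Rightarrow> ('a \<Rightarrow> 'a) \<Rightarrow> real \<Rightarrow> bool" where
  "admissible_bound K TA B \<gamma>max \<longleftrightarrow> (\<forall>\<gamma>. 0 < \<gamma> \<and> \<gamma> < \<gamma>max \<longrightarrow> cocoercive_on K (1/2) (S_fb TA \<gamma> B))"

lemma T_fwd_nonexpansive:
  assumes "L > 0" "cocoercive_on K (1 / L) B" "0 < \<gamma>" "\<gamma> < 2 / L"
  shows "1-lipschitz_on K (T_fwd \<gamma> B)"
proof (rule lipschitz_onI)
  fix x y assume xy: "x \<in> K" "y \<in> K"
  define u v where "u = x - y" and "v = B x - B y"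
  have c: "u \<bullet> v \<ge> 1 / L * (norm v)\<^sup>2"
    using assms(2) xy by (simp add: cocoercive_on_def u_def v_def)
  have "\<gamma> * (norm v)\<^sup>2 \<le> 2 / L * (norm v)\<^sup>2"
    using assms(4) by (intro mult_right_mono) auto
  with c have "\<gamma> * (norm v)\<^sup>2 \<le> 2 * (u \<bullet> v)" by simp
  then have "\<gamma> * (\<gamma> * (norm v)\<^sup>2) \<le> \<gamma> * (2 * (u \<bullet> v))"
    using assms(3) by (intro mult_left_mono) auto
  then have "(norm (u - \<gamma> *\<^sub>R v))\<^sup>2 \<le> (norm u)\<^sup>2"
    by (simp add: power2_norm_eq_inner inner_diff_left inner_diff_right inner_commute)
  then have "norm (u - \<gamma> *\<^sub>R v) \<le> norm u" by (rule power2_le_imp_le) simp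
  moreover have "T_fwd \<gamma> B x - T_fwd \<gamma> B y = u - \<gamma> *\<^sub>R v"
    by (simp add: T_fwd_def u_def v_def algebra_simps)
  ultimately show "dist (T_fwd \<gamma> B x) (T_fwd \<gamma> B y) \<le> 1 * dist x y"
    by (simp add: dist_norm u_def)
qed simp

lemma admissible_bound_two_over_L:
  assumes "hilbert_family H" "K = hilbert_prod H"
    and "1-lipschitz_on K TA" "B ` K \<subseteq> K" "L > 0" "cocoercive_on K (1 / L) B"
  shows "admissible_bound K TA B (2 / L)"
  unfolding admissible_bound_def cocoercive_on_def
proof (intro allI impI ballI, elim conjE)
  fix \<gamma> x y assume g: "0 < \<gamma>" "\<gamma> < 2 / L" and xy: "x \<in> K" "y \<in> K"
  have F: "T_fwd \<gamma> B z \<in> K" if z: "z \<in> K" for z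
  proof -
    have "B z \<in> K" using assms(4) z by blast
    then have "z $ i - \<gamma> *\<^sub>R (B z $ i) \<in> H i" for i
      using assms(1,2) z unfolding hilbert_family_def hilbert_prod_def
      by (intro subspace_diff subspace_scale) auto
    then show ?thesis by (simp add: assms(2) hilbert_prod_def T_fwd_def)
  qed
  define u s where "u = x - y" and "s = S_fb TA \<gamma> B x - S_fb TA \<gamma> B y"
  have "norm (T_fb TA \<gamma> B x - T_fb TA \<gamma> B y) \<le> norm (T_fwd \<gamma> B x - T_fwd \<gamma> B y)"
    using lipschitz_on_normD[OF assms(3) F F, OF xy] by (simp add: T_fb_def)
  also have "\<dots> \<le> norm u"
    using lipschitz_on_normD[OF T_fwd_nonexpansive[OF assms(5,6) g] xy] by (simp add: u_def)
  also have "T_fb TA \<gamma> B x - T_fb TA \<gamma> B y = u - s"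
    by (simp add: u_def s_def S_fb_def)
  finally have "(norm (u - s))\<^sup>2 \<le> (norm u)\<^sup>2" by (intro power_mono) auto
  then show "1 / 2 * (norm (S_fb TA \<gamma> B x - S_fb TA \<gamma> B y))\<^sup>2 \<le> (x - y) \<bullet> (S_fb TA \<gamma> B x - S_fb TA \<gamma> B y)"
    unfolding u_def[symmetric] s_def[symmetric]
    by (simp add: power2_norm_eq_inner inner_diff_left inner_diff_right inner_commute)
qed

(* Truncated subtraction encodes the start-up convention x_j = x_0 for j < 0: a delay reaching
   beyond the start reads the initial point. *)
definition lag :: "(nat \<Rightarrow> 'a::real_inner) \<Rightarrow> nat \<Rightarrow> nat \<Rightarrow> 'a" where
  "lag x k l = (\<Sum>m=k - l..<k. x (Suc m) - x m)"

lemma outdated_iterate: "x k - lag x k l = x (k - l)"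
  by (simp add: lag_def sum_Suc_diff')

(* The block assembly {v_k^i[i]}_i, where v_k^i is the lag of agent i with delay l k i. *)
definition assembled_lag ::
    "(nat \<Rightarrow> 'h::real_inner^'n::finite) \<Rightarrow> (nat \<Rightarrow> 'n \<Rightarrow> nat) \<Rightarrow> nat \<Rightarrow> 'h^'n" where
  "assembled_lag x l k = (\<chi> i. lag x k (l k i) $ i)"

definition d_err :: "real \<Rightarrow> ('a::real_inner \<Rightarrow> 'a) \<Rightarrow> 'a \<Rightarrow> 'a \<Rightarrow> 'a" where
  "d_err \<gamma> B x a = \<gamma> *\<^sub>R B x - \<gamma> *\<^sub>R B (x - a) - a"

definition e_err ::
    "('a::real_inner \<Rightarrow> 'a) \<Rightarrow> real \<Rightarrow> ('a \<Rightarrow> 'a) \<Rightarrow> real \<Rightarrow> 'a \<Rightarrow> 'a \<Rightarrow> 'a \<Rightarrow> 'a \<Rightarrow> 'a" where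
  "e_err TA \<gamma> B \<beta> x a b c =
     TA (T_fwd \<gamma> B x + d_err \<gamma> B x a + \<beta> *\<^sub>R (c - b)) - TA (T_fwd \<gamma> B x)"

end

theory Submission
  imports Defs
begin

text \<open>
  Write \<open>V k\<close> for the squared distance of the \<open>k\<close>-th iterate to the fixed point, and let the window of
  \<open>k\<close> consist of \<open>k\<close> and the \<open>6\<tau>\<close> indices before it. The idea is to treat asynchrony as a
  perturbation \<open>e k\<close> of a synchronous relaxed step, small of order \<open>\<eta>\<close> because outdated data differ
  from current data only by a bounded number of steps, each of which has length of order \<open>\<eta>\<close>.

  A synchronous step contracts: quasi-strong monotonicity gives the factor \<open>1 - \<eta> * \<nu>\<close>, while
  cocoercivity of \<open>S\<close> absorbs the quadratic term. Two applications of Young's inequality, with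
  parameters \<open>\<epsilon>\<close> and \<open>\<delta>\<close>, separate the perturbation (\<open>perturbed_relaxed_step\<close>):
  \<open>V (k + 1) \<le> r * V k + (\<eta> / \<epsilon> + \<eta>\<^sup>2 * (1 + \<delta>) / \<delta>) * (norm (e k))\<^sup>2\<close>.

  The perturbation is bounded in two passes (\<open>norm_delay_error_le\<close>). If all distances in the window
  are at most \<open>D\<close>, the triangle inequality through the fixed point bounds the errors at the
  \<open>3\<tau>\<close> indices before \<open>k\<close> by a multiple of \<open>D\<close>, and so the lengths of the steps taken there by a
  multiple of \<open>\<eta> * D\<close>. Summing these short steps over the delays bounds \<open>norm (e k)\<close> by
  \<open>\<eta> * X * D\<close>. Each pass reaches back by the largest delay \<open>3\<tau>\<close>, hence the window length \<open>6\<tau>\<close>.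

  Together, \<open>V (k + 1) \<le> r * V k + q * max V\<close> with the maximum over the window. The bound on \<open>\<eta>\<close> makes
  \<open>r + q < 1\<close>, and such a delayed recurrence loses a factor \<open>r + q\<close> at least once every \<open>1 + 6\<tau>\<close> indices
  (\<open>delayed_recurrence_linear_rate\<close>). Nonnegativity of \<open>r\<close> comes from \<open>\<nu> \<le> 2\<close>, which monotonicity and
  cocoercivity of \<open>S\<close> force as soon as the space has a point other than the fixed point.
\<close>

section \<open>Delayed scalar recurrences\<close>

text \<open>
  A single factor \<open>s ^ Suc M\<close> is gained per step, relative to the oldest value in the window,
  which is at most \<open>M\<close> indices before \<open>k\<close> and hence carries at least the power \<open>s ^ (k - M)\<close>. At start-up
  (\<open>k < M\<close>) the truncated difference is \<open>0\<close> and \<open>s \<le> 1\<close> makes up for the missing powers.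
\<close>

lemma delayed_recurrence_linear_rate:
  fixes V :: "nat \<Rightarrow> real"
  assumes s: "0 \<le> s" "s \<le> 1" and V0: "0 \<le> V 0"
    and rec: "\<And>k W. (\<And>m. m \<in> {k - M..k} \<Longrightarrow> V m \<le> W) \<Longrightarrow> V (Suc k) \<le> s ^ Suc M * W"
  shows "V k \<le> s ^ k * V 0"
proof (induction k rule: less_induct)
  case (less k)
  show ?case
  proof (cases k)
    case 0
    then show ?thesis by simp
  next
    case (Suc j)
    have "V m \<le> s ^ (j - M) * V 0" if "m \<in> {j - M..j}" for m
    proof -
      have "V m \<le> s ^ m * V 0" using less.IH[of m] Suc that by auto
      also have "\<dots> \<le> s ^ (j - M) * V 0"
        using that s V0 by (intro mult_right_mono power_decreasing) auto
      finally show ?thesis .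
    qed
    then have "V (Suc j) \<le> s ^ Suc M * (s ^ (j - M) * V 0)" by (rule rec)
    also have "\<dots> = s ^ (Suc M + (j - M)) * V 0" by (simp add: power_add)
    also have "\<dots> \<le> s ^ Suc j * V 0"
      using s V0 by (intro mult_right_mono power_decreasing) auto
    finally show ?thesis using Suc by simp
  qed
qed

section \<open>One perturbed step\<close>

lemma cocoercive_on_norm_diff_le:
  assumes "cocoercive_on K c F" "0 < c" "x \<in> K" "y \<in> K"
  shows "norm (F x - F y) \<le> norm (x - y) / c"
proof (cases "F x = F y")
  case False
  have "c * (norm (F x - F y))\<^sup>2 \<le> (x - y) \<bullet> (F x - F y)"
    using assms by (simp add: cocoercive_on_def)
  also have "\<dots> \<le> norm (x - y) * norm (F x - F y)" by (rule norm_cauchy_schwarz)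
  finally have "c * norm (F x - F y) \<le> norm (x - y)"
    using False by (simp add: power2_eq_square)
  then show ?thesis using assms(2) by (simp add: field_simps)
qed (use assms in auto)

lemma norm_diff_power2_le_Young:
  fixes w e :: "'a::real_inner"
  assumes "\<delta> > 0"
  shows "(norm (w - e))\<^sup>2 \<le> (1 + \<delta>) * (norm w)\<^sup>2 + (1 + \<delta>) / \<delta> * (norm e)\<^sup>2"
proof -
  have "0 \<le> (norm (\<delta> *\<^sub>R w + e))\<^sup>2" by simp
  also have "\<dots> = \<delta>\<^sup>2 * (norm w)\<^sup>2 + 2 * \<delta> * (w \<bullet> e) + (norm e)\<^sup>2"
    unfolding power2_norm_eq_inner
    by (simp add: inner_add_left inner_add_right inner_commute power2_eq_square algebra_simps)
  finally have "0 \<le> \<delta> * (norm w)\<^sup>2 + 2 * (w \<bullet> e) + (norm e)\<^sup>2 / \<delta>"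
    using assms by (simp add: field_simps power2_eq_square)
  moreover have "(norm (w - e))\<^sup>2 = (norm w)\<^sup>2 - 2 * (w \<bullet> e) + (norm e)\<^sup>2"
    by (simp add: power2_norm_eq_inner inner_diff_left inner_diff_right inner_commute)
  moreover have "(1 + \<delta>) / \<delta> * (norm e)\<^sup>2 = (norm e)\<^sup>2 + (norm e)\<^sup>2 / \<delta>"
    using assms by (simp add: field_simps)
  ultimately show ?thesis by (simp add: algebra_simps)
qed

text \<open>
  In the square of the step, the linear term contributes \<open>- 2 * \<eta> * (u \<bullet> w)\<close>. Since
  \<open>\<eta> * (1 + \<delta>) \<le> 1 / 2\<close>, cocoercivity lets one half of it pay for the quadratic term in \<open>w\<close>; the other half
  yields the contraction by strong monotonicity. The cross term with \<open>e\<close> costs a further \<open>\<eta> * \<epsilon>\<close>.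
\<close>

lemma perturbed_relaxed_step:
  fixes u w e :: "'a::real_inner"
  assumes coco: "1 / 2 * (norm w)\<^sup>2 \<le> u \<bullet> w" and mono: "\<nu> * (norm u)\<^sup>2 \<le> u \<bullet> w"
    and pos: "0 < \<eta>" "0 < \<delta>" "0 < \<epsilon>" and eta: "\<eta> * (1 + \<delta>) \<le> 1 / 2"
  shows "(norm (u - \<eta> *\<^sub>R (w - e)))\<^sup>2
    \<le> (1 - \<eta> * (\<nu> - \<epsilon>)) * (norm u)\<^sup>2 + (\<eta> / \<epsilon> + \<eta>\<^sup>2 * (1 + \<delta>) / \<delta>) * (norm e)\<^sup>2"
proof -
  have cross: "2 * (u \<bullet> e) \<le> \<epsilon> * (norm u)\<^sup>2 + (norm e)\<^sup>2 / \<epsilon>"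
  proof -
    have "0 \<le> (norm (\<epsilon> *\<^sub>R u - e))\<^sup>2" by simp
    also have "\<dots> = \<epsilon>\<^sup>2 * (norm u)\<^sup>2 - 2 * \<epsilon> * (u \<bullet> e) + (norm e)\<^sup>2"
      unfolding power2_norm_eq_inner
      by (simp add: inner_diff_left inner_diff_right inner_commute power2_eq_square algebra_simps)
    finally show ?thesis using pos by (simp add: field_simps power2_eq_square)
  qed
  have quad: "(norm (w - e))\<^sup>2 \<le> (1 + \<delta>) * (norm w)\<^sup>2 + (1 + \<delta>) / \<delta> * (norm e)\<^sup>2"
    using pos by (intro norm_diff_power2_le_Young)
  have "\<eta> * (1 + \<delta>) * (norm w)\<^sup>2 \<le> 1 / 2 * (norm w)\<^sup>2"
    using eta by (intro mult_right_mono) auto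
  with coco have absorb: "\<eta> * (1 + \<delta>) * (norm w)\<^sup>2 \<le> u \<bullet> w" by linarith
  have "(norm (u - \<eta> *\<^sub>R (w - e)))\<^sup>2
      = (norm u)\<^sup>2 - 2 * \<eta> * (u \<bullet> w) + \<eta> * (2 * (u \<bullet> e)) + \<eta> * (\<eta> * (norm (w - e))\<^sup>2)"
    by (simp add: power2_norm_eq_inner inner_diff_left inner_diff_right inner_commute algebra_simps)
  also have "\<dots> \<le> (norm u)\<^sup>2 - 2 * \<eta> * (u \<bullet> w) + \<eta> * (\<epsilon> * (norm u)\<^sup>2 + (norm e)\<^sup>2 / \<epsilon>)
      + \<eta> * (\<eta> * ((1 + \<delta>) * (norm w)\<^sup>2 + (1 + \<delta>) / \<delta> * (norm e)\<^sup>2))"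
    using pos cross quad by (intro add_mono mult_left_mono order_refl) auto
  also have "\<dots> = (norm u)\<^sup>2 - 2 * \<eta> * (u \<bullet> w) + \<eta> * \<epsilon> * (norm u)\<^sup>2
      + \<eta> * (\<eta> * (1 + \<delta>) * (norm w)\<^sup>2) + (\<eta> / \<epsilon> + \<eta>\<^sup>2 * (1 + \<delta>) / \<delta>) * (norm e)\<^sup>2"
    by (simp add: algebra_simps power2_eq_square)
  also have "\<dots> \<le> (norm u)\<^sup>2 - 2 * \<eta> * (u \<bullet> w) + \<eta> * \<epsilon> * (norm u)\<^sup>2
      + \<eta> * (u \<bullet> w) + (\<eta> / \<epsilon> + \<eta>\<^sup>2 * (1 + \<delta>) / \<delta>) * (norm e)\<^sup>2"
    using pos absorb by (intro add_mono mult_left_mono order_refl) auto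
  also have "\<dots> \<le> (norm u)\<^sup>2 - \<eta> * (\<nu> * (norm u)\<^sup>2) + \<eta> * \<epsilon> * (norm u)\<^sup>2
      + (\<eta> / \<epsilon> + \<eta>\<^sup>2 * (1 + \<delta>) / \<delta>) * (norm e)\<^sup>2"
    using mult_left_mono[OF mono, of \<eta>] pos by simp
  finally show ?thesis by (simp add: algebra_simps)
qed

section \<open>Errors caused by outdated blocks\<close>

lemma norm_vec_le_card_mult:
  fixes v :: "'h::real_normed_vector^'n::finite"
  assumes "\<And>i. norm (v $ i) \<le> R"
  shows "norm v \<le> real CARD('n) * R"
proof -
  have "norm v \<le> (\<Sum>i\<in>UNIV. norm (v $ i))"
    unfolding norm_vec_def by (rule L2_set_le_sum) simp
  also have "\<dots> \<le> real CARD('n) * R"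
    using assms by (intro sum_bounded_above)
  finally show ?thesis .
qed

lemma assembled_lag_nth: "assembled_lag x l k $ i = x k $ i - x (k - l k i) $ i"
  by (simp add: assembled_lag_def lag_def sum_Suc_diff')

lemma norm_assembled_lag_diff_le:
  fixes x :: "nat \<Rightarrow> 'h::real_inner^'n::finite"
  assumes "\<And>i. l k i \<le> M" "\<And>i. l' k i \<le> M"
    and "\<And>i j. i \<in> {k - M..k} \<Longrightarrow> j \<in> {k - M..k} \<Longrightarrow> norm (x i - x j) \<le> R"
  shows "norm (assembled_lag x l k - assembled_lag x l' k) \<le> real CARD('n) * R"
proof (rule norm_vec_le_card_mult)
  fix i
  have "norm ((assembled_lag x l k - assembled_lag x l' k) $ i)
      = norm ((x (k - l' k i) - x (k - l k i)) $ i)"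
    by (simp add: assembled_lag_nth)
  also have "\<dots> \<le> norm (x (k - l' k i) - x (k - l k i))" by (rule Finite_Cartesian_Product.norm_nth_le)
  also have "\<dots> \<le> R"
    using assms(1,2)[of i] by (intro assms(3)) auto
  finally show "norm ((assembled_lag x l k - assembled_lag x l' k) $ i) \<le> R" .
qed

lemma norm_assembled_lag_le:
  fixes x :: "nat \<Rightarrow> 'h::real_inner^'n::finite"
  assumes "\<And>i. l k i \<le> M"
    and "\<And>i j. i \<in> {k - M..k} \<Longrightarrow> j \<in> {k - M..k} \<Longrightarrow> norm (x i - x j) \<le> R"
  shows "norm (assembled_lag x l k) \<le> real CARD('n) * R"
proof -
  have "assembled_lag x (\<lambda>_ _. 0) k = 0"
    by (simp add: vec_eq_iff assembled_lag_nth)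
  then show ?thesis
    using norm_assembled_lag_diff_le[of l k M "\<lambda>_ _. 0" x R] assms by simp
qed

lemma norm_diff_le_of_short_steps:
  fixes x :: "nat \<Rightarrow> 'a::real_normed_vector"
  assumes "\<And>m. m \<in> {k - M..<k} \<Longrightarrow> norm (x (Suc m) - x m) \<le> E" "0 \<le> E"
    and "i \<in> {k - M..k}" "j \<in> {k - M..k}"
  shows "norm (x i - x j) \<le> real M * E"
  using assms(3,4)
proof (induction i j rule: linorder_wlog)
  case (le i j)
  have "norm (x i - x j) = norm (\<Sum>m = i..<j. x (Suc m) - x m)"
    using le by (simp add: sum_Suc_diff' norm_minus_commute)
  also have "\<dots> \<le> real (card {i..<j}) * E"
    using le by (intro sum_norm_bound assms(1)) auto
  also have "\<dots> \<le> real M * E"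
    using le assms(2) by (intro mult_right_mono) auto
  finally show ?case .
qed (simp add: norm_minus_commute)

text \<open>
  The two passes of the delay estimate. The inner one, at the last \<open>3\<tau>\<close> indices, only uses that
  any two points of the window are at distance at most \<open>2 * D\<close>, through \<open>p\<close>; this bounds the
  error by a multiple of \<open>D\<close> and hence the step length by \<open>\<eta>\<close> times such a multiple. The
  outer one sums these steps over the delays at \<open>k\<close>. In the constant, \<open>\<kappa>\<close> stands for \<open>1 + \<gamma> * L\<close>; treating the difference \<open>c k - b k\<close> as a whole
  makes the inertial contribution proportional to \<open>3\<tau>\<close> rather than to the sum \<open>5\<tau>\<close> of two delays.
\<close>

lemma norm_delay_error_le:
  fixes x e :: "nat \<Rightarrow> 'h::real_inner^'n::finite" and p :: "'h^'n"
  defines "n \<equiv> real CARD('n)"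
  assumes pos: "0 \<le> \<kappa>" "0 \<le> \<beta>" "0 \<le> \<eta>"
    and err: "\<And>m. norm (e m) \<le> \<kappa> * norm (assembled_lag x la m)
      + \<beta> * norm (assembled_lag x lc m - assembled_lag x lb m)"
    and step: "\<And>m. norm (x (Suc m) - x m) \<le> \<eta> * (2 * norm (x m - p) + norm (e m))"
    and delays: "\<And>m i. la m i \<le> 2 * \<tau>" "\<And>m i. lb m i \<le> 2 * \<tau>" "\<And>m i. lc m i \<le> 3 * \<tau>"
    and window: "\<And>m. m \<in> {k - 6 * \<tau>..k} \<Longrightarrow> norm (x m - p) \<le> D"
  shows "norm (e k) \<le> \<eta> * (n * ((\<kappa> + 2 * \<beta>) * n + 1) * (4 * real \<tau> * \<kappa> + 6 * \<beta> * real \<tau>)) * D"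
proof -
  have D: "0 \<le> D" using window[of k] order_trans[OF norm_ge_zero] by auto
  have n: "0 \<le> n" by (simp add: n_def)
  have delays': "la m i \<le> 3 * \<tau>" "lb m i \<le> 3 * \<tau>" for m i
    using delays(1,2)[of m i] by auto
  define E where "E = \<eta> * (2 * ((\<kappa> + 2 * \<beta>) * n + 1) * D)"
  have E: "0 \<le> E" using pos D n by (simp add: E_def)
  have short: "norm (x (Suc m) - x m) \<le> E" if m: "m \<in> {k - 3 * \<tau>..<k}" for m
  proof -
    have close: "norm (x i - x j) \<le> 2 * D"
      if "i \<in> {m - 3 * \<tau>..m}" "j \<in> {m - 3 * \<tau>..m}" for i j
    proof -
      have "norm (x i - p) \<le> D" "norm (x j - p) \<le> D"
        using that m by (auto intro!: window)
      then show ?thesis using norm_triangle_ineq4[of "x i - p" "x j - p"] by simp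
    qed
    have "norm (e m) \<le> \<kappa> * (n * (2 * D)) + \<beta> * (n * (2 * D))"
      unfolding n_def using pos close delays delays'
      by (intro order_trans[OF err] add_mono mult_left_mono
          norm_assembled_lag_le[where M = "3 * \<tau>"] norm_assembled_lag_diff_le[where M = "3 * \<tau>"]) auto
    also have "\<dots> \<le> 2 * (\<kappa> + 2 * \<beta>) * n * D"
      using pos D n by (simp add: algebra_simps)
    finally have "2 * norm (x m - p) + norm (e m) \<le> 2 * D + 2 * (\<kappa> + 2 * \<beta>) * n * D"
      using window[of m] m by (intro add_mono) auto
    then have "\<eta> * (2 * norm (x m - p) + norm (e m)) \<le> E"
      unfolding E_def using pos by (intro mult_left_mono) (simp_all add: algebra_simps)
    with step[of m] show ?thesis by linarith
  qed
  have "norm (e k) \<le> \<kappa> * (n * (real (2 * \<tau>) * E)) + \<beta> * (n * (real (3 * \<tau>) * E))"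
    unfolding n_def
  proof (intro order_trans[OF err] add_mono mult_left_mono)
    show "norm (assembled_lag x la k) \<le> real CARD('n) * (real (2 * \<tau>) * E)"
      using E delays short by (intro norm_assembled_lag_le norm_diff_le_of_short_steps) auto
    show "norm (assembled_lag x lc k - assembled_lag x lb k) \<le> real CARD('n) * (real (3 * \<tau>) * E)"
      using E delays delays' short
      by (intro norm_assembled_lag_diff_le norm_diff_le_of_short_steps) auto
  qed (use pos in auto)
  also have "\<dots> = \<eta> * (n * ((\<kappa> + 2 * \<beta>) * n + 1) * (4 * real \<tau> * \<kappa> + 6 * \<beta> * real \<tau>)) * D"
    by (simp add: E_def algebra_simps)
  finally show ?thesis .
qed

section \<open>The product space\<close>

lemma subspace_hilbert_prod: "hilbert_family H \<Longrightarrow> subspace (hilbert_prod H)"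
  by (auto simp: subspace_def hilbert_family_def hilbert_prod_def)

lemma assembled_lag_in_hilbert_prod:
  assumes H: "hilbert_family H" and x: "\<And>j. j \<le> k \<Longrightarrow> x j \<in> hilbert_prod H"
  shows "assembled_lag x l k \<in> hilbert_prod H"
proof -
  have "x k $ i - x (k - l k i) $ i \<in> H i" for i
    using H x[of k] x[of "k - l k i"]
    by (intro subspace_diff) (auto simp: hilbert_family_def hilbert_prod_def)
  then show ?thesis by (simp add: hilbert_prod_def assembled_lag_nth)
qed

lemma T_fwd_in_subspace:
  "subspace K \<Longrightarrow> B ` K \<subseteq> K \<Longrightarrow> z \<in> K \<Longrightarrow> T_fwd \<gamma> B z \<in> K"
  unfolding T_fwd_def by (intro subspace_diff subspace_scale) auto

text \<open>The deviation \<open>d_err\<close> only replaces the point of evaluation of the forward step.\<close>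

lemma T_fwd_plus_d_err: "T_fwd \<gamma> B x + d_err \<gamma> B x a = T_fwd \<gamma> B (x - a)"
  by (simp add: T_fwd_def d_err_def)

lemma norm_e_err_le:
  assumes K: "subspace K" "B ` K \<subseteq> K" "x \<in> K" "a \<in> K" "b \<in> K" "c \<in> K"
    and TA: "1-lipschitz_on K TA" and B: "L > 0" "cocoercive_on K (1 / L) B"
    and pos: "0 < \<gamma>" "0 \<le> \<beta>"
  shows "norm (e_err TA \<gamma> B \<beta> x a b c) \<le> (1 + \<gamma> * L) * norm a + \<beta> * norm (c - b)"
proof -
  have xa: "x - a \<in> K" using K by (intro subspace_diff)
  have "T_fwd \<gamma> B (x - a) + \<beta> *\<^sub>R (c - b) \<in> K"
    using K xa by (intro subspace_add T_fwd_in_subspace subspace_scale subspace_diff) auto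
  then have "norm (e_err TA \<gamma> B \<beta> x a b c)
      \<le> norm (T_fwd \<gamma> B (x - a) + \<beta> *\<^sub>R (c - b) - T_fwd \<gamma> B x)"
    using lipschitz_on_normD[OF TA _ T_fwd_in_subspace[OF K(1-3)]]
    by (simp add: e_err_def T_fwd_plus_d_err)
  also have "T_fwd \<gamma> B (x - a) + \<beta> *\<^sub>R (c - b) - T_fwd \<gamma> B x
      = \<gamma> *\<^sub>R (B x - B (x - a)) - a + \<beta> *\<^sub>R (c - b)"
    by (simp add: T_fwd_def algebra_simps)
  also have "norm \<dots> \<le> norm (\<gamma> *\<^sub>R (B x - B (x - a)) - a) + norm (\<beta> *\<^sub>R (c - b))"
    by (rule norm_triangle_ineq)
  also have "\<dots> \<le> norm (\<gamma> *\<^sub>R (B x - B (x - a))) + norm a + norm (\<beta> *\<^sub>R (c - b))"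
    by (intro add_right_mono norm_triangle_ineq4)
  also have "\<dots> = \<gamma> * norm (B x - B (x - a)) + norm a + \<beta> * norm (c - b)"
    using pos by simp
  also have "\<dots> \<le> \<gamma> * (L * norm a) + norm a + \<beta> * norm (c - b)"
    using pos cocoercive_on_norm_diff_le[OF B(2) _ K(3) xa] B(1)
    by (intro add_right_mono mult_left_mono) (auto simp: mult.commute)
  finally show ?thesis by (simp add: algebra_simps)
qed

section \<open>The rate\<close>

text \<open>
  The two bounds on \<open>\<eta>\<close> enter separately: the first caps \<open>\<eta> * (1 + \<delta>) / \<delta>\<close> by \<open>1 / (2 * \<delta>)\<close>, so that
  the bracket in \<open>q\<close> is at most \<open>(2 * \<delta> + \<epsilon>) / (2 * \<delta> * \<epsilon>)\<close>; the second is what makes \<open>(\<eta> * X)\<^sup>2\<close> times this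
  less than \<open>\<nu> - \<epsilon>\<close>.
\<close>

lemma rate_less_one:
  fixes \<eta> \<delta> \<epsilon> \<nu> X :: real
  assumes pos: "0 < \<eta>" "0 < \<delta>" "0 < \<epsilon>" "0 < X" and eta: "\<eta> * (1 + \<delta>) \<le> 1 / 2"
    and eta': "\<eta> < 1 / X * sqrt (2 * \<delta> * \<epsilon> * (\<nu> - \<epsilon>) / (2 * \<delta> + \<epsilon>))"
  shows "1 - \<eta> * (\<nu> - \<epsilon>) + \<eta> ^ 3 * X\<^sup>2 * (1 / \<epsilon> + \<eta> * (1 + \<delta>) / \<delta>) < 1"
proof -
  let ?Z = "2 * \<delta> * \<epsilon> * (\<nu> - \<epsilon>) / (2 * \<delta> + \<epsilon>)"
  let ?C = "(2 * \<delta> + \<epsilon>) / (2 * \<delta> * \<epsilon>)"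
  have C: "0 < ?C" using pos by simp
  have lt: "\<eta> * X < sqrt ?Z" using eta' pos by (simp add: field_simps)
  have "0 < \<eta> * X" using pos by simp
  with lt have Z: "0 < ?Z" by (metis less_trans real_sqrt_gt_0_iff)
  have "(\<eta> * X)\<^sup>2 < (sqrt ?Z)\<^sup>2"
    using lt pos by (intro power_strict_mono) auto
  then have sq: "(\<eta> * X)\<^sup>2 < ?Z" using Z by simp
  have "\<eta> * (1 + \<delta>) / \<delta> \<le> 1 / 2 / \<delta>" using eta pos by (intro divide_right_mono) auto
  moreover have "1 / \<epsilon> + 1 / 2 / \<delta> = ?C" using pos by (simp add: field_simps)
  ultimately have "1 / \<epsilon> + \<eta> * (1 + \<delta>) / \<delta> \<le> ?C" by linarith
  then have "(\<eta> * X)\<^sup>2 * (1 / \<epsilon> + \<eta> * (1 + \<delta>) / \<delta>) \<le> (\<eta> * X)\<^sup>2 * ?C"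
    by (intro mult_left_mono) auto
  also have "\<dots> < ?Z * ?C" using sq C by (rule mult_strict_right_mono)
  also have "\<dots> = \<nu> - \<epsilon>"
  proof -
    have "2 * \<delta> + \<epsilon> \<noteq> 0" "\<delta> \<noteq> 0" "\<epsilon> \<noteq> 0" using pos by auto
    then show ?thesis by simp
  qed
  finally have "\<eta> * ((\<eta> * X)\<^sup>2 * (1 / \<epsilon> + \<eta> * (1 + \<delta>) / \<delta>)) < \<eta> * (\<nu> - \<epsilon>)"
    using pos by simp
  then show ?thesis by (simp add: power2_eq_square power3_eq_cube mult.assoc mult.left_commute)
qed

theorem theorem5p1:
  fixes H :: "'n::finite \<Rightarrow> 'h::real_inner set"
    and K :: "('h^'n) set"
    and A :: "'n \<Rightarrow> 'h \<Rightarrow> 'h"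
    and TA B :: "'h^'n \<Rightarrow> 'h^'n"
    and L \<gamma> \<gamma>max \<nu> \<delta> \<epsilon> \<beta> \<eta> X Y s :: real
    and r q :: "real \<Rightarrow> real"
    and \<tau> N :: nat
    and la lb lc :: "nat \<Rightarrow> 'n \<Rightarrow> nat"
    and x a b c e :: "nat \<Rightarrow> 'h^'n"
    and xs :: "'h^'n"
  assumes "hilbert_family H" and "K = hilbert_prod H" and "N = CARD('n)"
    and "\<And>i. A i ` H i \<subseteq> H i" and "TA = separable_op A" and "1-lipschitz_on K TA"
    and "B ` K \<subseteq> K" and "L > 0" and "cocoercive_on K (1 / L) B"
    and "admissible_bound K TA B \<gamma>max" and "0 < \<gamma>" and "\<gamma> < \<gamma>max"
    and "\<nu> > 0" and "quasi_strongly_monotone_on K \<nu> (S_fb TA \<gamma> B)"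
    and "xs \<in> zer K (S_fb TA \<gamma> B)"
    and "\<delta> > 0" and "0 < \<epsilon>" and "\<epsilon> < \<nu>" and "\<beta> > 0"
    and "\<tau> \<ge> 1"
    and "\<And>k i. la k i \<in> {1..2 * \<tau>}"
    and "\<And>k i. lb k i \<in> {1..2 * \<tau>}"
    and "\<And>k i. lc k i \<in> {1..3 * \<tau>}"
    and "\<And>k. a k = assembled_lag x la k"
    and "\<And>k. b k = assembled_lag x lb k"
    and "\<And>k. c k = assembled_lag x lc k"
    and "\<And>k. e k = e_err TA \<gamma> B \<beta> (x k) (a k) (b k) (c k)"
    and "x 0 \<in> K"
    and "\<And>k. x (Suc k) = x k + \<eta> *\<^sub>R (T_fb TA \<gamma> B (x k) - x k + e k)"
    and "Y = 1 + \<gamma> * L + 2 * \<beta>"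
    and "X = real N * (Y * real N + 1) * (4 * real \<tau> * (1 + \<gamma> * L) + 6 * \<beta> * real \<tau>)"
    and "\<And>t. r t = 1 - t * (\<nu> - \<epsilon>)"
    and "\<And>t. q t = t ^ 3 * X\<^sup>2 * (1 / \<epsilon> + t * (1 + \<delta>) / \<delta>)"
    and "s = (r \<eta> + q \<eta>) powr (1 / (1 + 6 * real \<tau>))"
    and "\<eta> > 0"
    and "\<eta> < min (1 / (2 * (1 + \<delta>))) (1 / X * sqrt (2 * \<delta> * \<epsilon> * (\<nu> - \<epsilon>) / (2 * \<delta> + \<epsilon>)))"
  shows "r \<eta> + q \<eta> < 1 \<and> (\<forall>k\<ge>1. (norm (x k - xs))\<^sup>2 \<le> s ^ k * (norm (x 0 - xs))\<^sup>2)"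
proof -
  note as = assms
  define S where "S = S_fb TA \<gamma> B"
  have sub: "subspace K" using as(1,2) subspace_hilbert_prod by blast
  have TAK: "TA z \<in> K" if "z \<in> K" for z
    using that as(4) by (auto simp: as(2,5) hilbert_prod_def separable_op_def)
  have coco: "cocoercive_on K (1/2) S" using as(10,11,12) by (auto simp: admissible_bound_def S_def)
  have xsK: "xs \<in> K" and Sxs: "S xs = 0" using as(15) by (auto simp: zer_def S_def)
  have mono: "\<nu> * (norm (z - xs))\<^sup>2 \<le> (z - xs) \<bullet> S z" if "z \<in> K" for z
    using as(14,15) that by (auto simp: quasi_strongly_monotone_on_def S_def)
  have half: "1 / 2 * (norm (S z))\<^sup>2 \<le> (z - xs) \<bullet> S z" if "z \<in> K" for z
    using bspec[OF bspec[OF coco[unfolded cocoercive_on_def] that] xsK] Sxs by simp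
  have S2: "norm (S z) \<le> 2 * norm (z - xs)" if "z \<in> K" for z
    using cocoercive_on_norm_diff_le[OF coco _ that xsK] Sxs by simp
  have iter: "x (Suc k) = x k - \<eta> *\<^sub>R (S (x k) - e k)" for k
    by (simp add: as(29) S_def S_fb_def algebra_simps)

  have abcK: "a k \<in> K" "b k \<in> K" "c k \<in> K" if "\<And>j. j \<le> k \<Longrightarrow> x j \<in> K" for k
    using that assembled_lag_in_hilbert_prod[OF as(1)] by (auto simp: as(2,24,25,26))
  have xK: "x k \<in> K" for k
  proof (induction k rule: less_induct)
    case (less k)
    show ?case
    proof (cases k)
      case 0
      then show ?thesis using as(28) by simp
    next
      case (Suc j)
      have le: "x i \<in> K" if "i \<le> j" for i using less.IH[of i] that Suc by simp
      have "x (Suc j) = x j + \<eta> *\<^sub>R (TA (T_fwd \<gamma> B (x j - a j) + \<beta> *\<^sub>R (c j - b j)) - x j)"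
        unfolding as(29)[of j] by (simp add: as(27) e_err_def T_fb_def T_fwd_plus_d_err)
      moreover have "T_fwd \<gamma> B (x j - a j) + \<beta> *\<^sub>R (c j - b j) \<in> K"
        using sub as(7) le[OF order_refl] abcK[OF le]
        by (intro subspace_add T_fwd_in_subspace subspace_scale subspace_diff) auto
      then have "TA (T_fwd \<gamma> B (x j - a j) + \<beta> *\<^sub>R (c j - b j)) \<in> K" by (rule TAK)
      ultimately show ?thesis
        using sub le[OF order_refl] Suc by (simp add: subspace_add subspace_scale subspace_diff)
    qed
  qed

  have eta: "\<eta> * (1 + \<delta>) \<le> 1 / 2" "\<eta> < 1 / 2"
  proof -
    have "\<eta> < 1 / (2 * (1 + \<delta>))" using as(36) by simp
    then have "\<eta> * (1 + \<delta>) < 1 / 2" using as(16) by (simp add: field_simps)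
    moreover have "\<eta> < \<eta> * (1 + \<delta>)" using as(16,35) by simp
    ultimately show "\<eta> * (1 + \<delta>) \<le> 1 / 2" "\<eta> < 1 / 2" by linarith+
  qed
  have Y: "0 < Y" using as(8,11,19) by (simp add: as(30) add_pos_pos)
  have X: "0 < X"
  proof -
    have "0 < real N" "0 < real \<tau>" "0 < \<gamma> * L" using as(3,8,11,20) by auto
    then show ?thesis unfolding as(31) using Y as(8,11,19)
      by (intro mult_pos_pos add_pos_pos) auto
  qed
  have rate: "r \<eta> + q \<eta> < 1"
    unfolding as(32,33) using as(16,17,35,36) X eta by (intro rate_less_one) auto

  have eX: "norm (e k) \<le> \<eta> * X * D"
    if "\<And>m. m \<in> {k - 6 * \<tau>..k} \<Longrightarrow> norm (x m - xs) \<le> D" for k D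
  proof -
    have "norm (x (Suc m) - x m) \<le> \<eta> * (2 * norm (x m - xs) + norm (e m))" for m
    proof -
      have "norm (x (Suc m) - x m) = \<eta> * norm (S (x m) - e m)" using as(35) by (simp add: iter)
      also have "\<dots> \<le> \<eta> * (norm (S (x m)) + norm (e m))"
        using as(35) by (intro mult_left_mono norm_triangle_ineq4) auto
      also have "\<dots> \<le> \<eta> * (2 * norm (x m - xs) + norm (e m))"
        using as(35) S2[OF xK[of m]] by (intro mult_left_mono add_right_mono) auto
      finally show ?thesis .
    qed
    moreover have "norm (e m) \<le> (1 + \<gamma> * L) * norm (assembled_lag x la m)
      + \<beta> * norm (assembled_lag x lc m - assembled_lag x lb m)" for m
      using norm_e_err_le[OF sub as(7) xK abcK[OF xK] as(6,8,9,11)] as(19)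
      by (simp add: as(24-27))
    moreover have "la m i \<le> 2 * \<tau>" "lb m i \<le> 2 * \<tau>" "lc m i \<le> 3 * \<tau>" for m i
      using as(21,22,23)[of m i] by auto
    ultimately show ?thesis
      unfolding as(3,30,31) using that as(8,11,19,35)
      by (intro norm_delay_error_le[where la = la and lb = lb and lc = lc]) auto
  qed

  have "(norm (x k - xs))\<^sup>2 \<le> s ^ k * (norm (x 0 - xs))\<^sup>2" for k
  proof (cases "\<exists>z\<in>K. z \<noteq> xs")
    case False
    then have "x j = xs" for j using xK by blast
    then show ?thesis by simp
  next
    case True
    then obtain z where z: "z \<in> K" "z \<noteq> xs" by blast
    \<comment> \<open>A point other than \<open>xs\<close> is needed to compare \<open>\<nu>\<close> with the Lipschitz constant \<open>2\<close> of \<open>S\<close>.\<close>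
    have "\<nu> * (norm (z - xs))\<^sup>2 \<le> norm (z - xs) * (2 * norm (z - xs))"
      using mono[OF z(1)] norm_cauchy_schwarz[of "z - xs" "S z"]
        mult_left_mono[OF S2[OF z(1)] norm_ge_zero[of "z - xs"]] by linarith
    then have "\<nu> \<le> 2" using z by (simp add: power2_eq_square)
    then have "\<eta> * (\<nu> - \<epsilon>) < 1 / 2 * 2"
      using eta(2) as(17,18,35) by (intro mult_strict_mono) auto
    then have r: "0 < r \<eta>" by (simp add: as(32))
    have q: "0 \<le> q \<eta>" unfolding as(33) using as(16,17,35) by auto
    have s: "0 \<le> s" "s \<le> 1" and s_pow: "s ^ Suc (6 * \<tau>) = r \<eta> + q \<eta>"
      using r q rate by (auto simp: as(34) powr_le1 powr_power simp del: power_Suc)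
    show ?thesis
    proof (rule delayed_recurrence_linear_rate[where M = "6 * \<tau>"])
      fix k W assume W: "\<And>m. m \<in> {k - 6 * \<tau>..k} \<Longrightarrow> (norm (x m - xs))\<^sup>2 \<le> W"
      have W0: "0 \<le> W" using W[of k] order_trans[OF zero_le_power2] by auto
      have "norm (e k) \<le> \<eta> * X * sqrt W"
        using W by (intro eX real_le_rsqrt) auto
      then have "(norm (e k))\<^sup>2 \<le> (\<eta> * X * sqrt W)\<^sup>2" by (intro power_mono) auto
      then have eW: "(norm (e k))\<^sup>2 \<le> (\<eta> * X)\<^sup>2 * W" using W0 by (simp add: power_mult_distrib)
      have "(norm (x (Suc k) - xs))\<^sup>2 = (norm (x k - xs - \<eta> *\<^sub>R (S (x k) - e k)))\<^sup>2"
        by (simp add: iter algebra_simps)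
      also have "\<dots> \<le> (1 - \<eta> * (\<nu> - \<epsilon>)) * (norm (x k - xs))\<^sup>2
          + (\<eta> / \<epsilon> + \<eta>\<^sup>2 * (1 + \<delta>) / \<delta>) * (norm (e k))\<^sup>2"
        using as(16,17,35) eta by (intro perturbed_relaxed_step half mono xK) auto
      also have "\<dots> \<le> r \<eta> * W + (\<eta> / \<epsilon> + \<eta>\<^sup>2 * (1 + \<delta>) / \<delta>) * ((\<eta> * X)\<^sup>2 * W)"
        using as(16,17,35) r W[of k] eW
        by (intro add_mono mult_mono) (auto simp: as(32))
      also have "\<dots> = (r \<eta> + q \<eta>) * W"
        by (simp add: as(33) algebra_simps power2_eq_square power3_eq_cube)
      finally show "(norm (x (Suc k) - xs))\<^sup>2 \<le> s ^ Suc (6 * \<tau>) * W" by (simp only: s_pow)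
    qed (use s in auto)
  qed
  with rate show ?thesis by blast
qed

end
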